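(* The isomorphism relation on countable partial orders is Borel reducible to the conjugacy relation on $\mathrm{Aut}(\mathcal P(3))$. Hence the conjugacy relation on $\mathrm{Aut}(\mathcal P(3))$ is Borel complete.
   Context: Let $\mathcal P$ be the generic countable homogeneous partial order (Fraïssé limit of finite partial orders), partitioned into three dense subsets $P_0,P_1,P_2$; equivalently, take the generic three-colored partial order $\mathcal P_3$ (Fraïssé limit of finite partial orders whose points are colored with three colors) with color classes $P_0,P_1,P_2$. The generic shuffled partial order $\mathcal P(3)$ is the digraph on the same underlying set defined as follows (where $\perp$ denotes incomparability in $\mathcal P$ and non-adjacency in $\mathcal P(3)$): if $x,y\in P_i$ then $x\to y$ iff $x<_{\mathcal P}y$; for $i\in\mathbb Z/3\mathbb Z$, $x\in P_i$ and $y\in P_{i+1}$, set $x\to y$ iff $x>_{\mathcal P}y$, $y\to x$ iff $x\perp_{\mathcal P}y$, and $x\perp y$ (no edge) iff $x<_{\mathcal P}y$. $\mathcal P(3)$ is a countable homogeneous digraph. $\mathrm{Aut}(\mathcal P(3))$ is a Polish group, and the conjugacy relation is $\phi\sim\psi$ iff $\alpha\phi\alpha^{-1}=\psi$ for some automorphism $\alpha$. Borel reducibility: $E\le_B F$ if there is a Borel $f$ with $x\mathrel{E}x'\iff f(x)\mathrel{F}f(x')$. Borel complete: reducible to the isomorphism relation on some class of countable structures (coded on $\mathbb N$), and every such isomorphism relation is Borel reducible to it. *)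

theory Defs
  imports "HOL-Analysis.Analysis"
begin

text \<open>Product sigma-algebra of countably many discrete spaces; for countable index
  and value types this is exactly the Borel sigma-algebra of the product topology
  (Cantor space / Baire space).\<close>
definition cyl_space :: "('i \<Rightarrow> 'a) measure" where
  "cyl_space = PiM UNIV (\<lambda>_. count_space UNIV)"

definition rel2_space :: "('i \<Rightarrow> 'j \<Rightarrow> 'a) measure" where
  "rel2_space = PiM UNIV (\<lambda>_. cyl_space)"

definition borel_reducible ::
  "'a measure \<Rightarrow> 'a set \<Rightarrow> ('a \<Rightarrow> 'a \<Rightarrow> bool) \<Rightarrow>
   'b measure \<Rightarrow> 'b set \<Rightarrow> ('b \<Rightarrow> 'b \<Rightarrow> bool) \<Rightarrow> bool" where
  "borel_reducible M X E N Y F \<longleftrightarrow>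
     (\<exists>f \<in> measurable (restrict_space M X) (restrict_space N Y).
        \<forall>x\<in>X. \<forall>x'\<in>X. E x x' \<longleftrightarrow> F (f x) (f x'))"

text \<open>Language: set of symbols L with arities ar. A structure is coded as
  A i xs (symbol i holds of tuple xs).\<close>
definition Mod :: "nat set \<Rightarrow> (nat \<Rightarrow> nat) \<Rightarrow> (nat \<Rightarrow> nat list \<Rightarrow> bool) set" where
  "Mod L ar = {A. \<forall>i xs. A i xs \<longrightarrow> i \<in> L \<and> length xs = ar i}"

definition iso_struct :: "(nat \<Rightarrow> nat list \<Rightarrow> bool) \<Rightarrow> (nat \<Rightarrow> nat list \<Rightarrow> bool) \<Rightarrow> bool" where
  "iso_struct A B \<longleftrightarrow> (\<exists>\<pi>. bij \<pi> \<and> (\<forall>i xs. A i xs \<longleftrightarrow> B i (map \<pi> xs)))"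

definition struct_space :: "(nat \<Rightarrow> nat list \<Rightarrow> bool) measure" where
  "struct_space = rel2_space"

definition borel_complete :: "'b measure \<Rightarrow> 'b set \<Rightarrow> ('b \<Rightarrow> 'b \<Rightarrow> bool) \<Rightarrow> bool" where
  "borel_complete N Y E \<longleftrightarrow>
     (\<exists>L ar. borel_reducible N Y E struct_space (Mod L ar) iso_struct) \<and>
     (\<forall>L ar. borel_reducible struct_space (Mod L ar) iso_struct N Y E)"

definition posets :: "(nat \<Rightarrow> nat \<Rightarrow> bool) set" where
  "posets = {R. (\<forall>x. R x x) \<and> (\<forall>x y. R x y \<and> R y x \<longrightarrow> x = y)
               \<and> (\<forall>x y z. R x y \<and> R y z \<longrightarrow> R x z)}"

definition iso_rel :: "(nat \<Rightarrow> nat \<Rightarrow> bool) \<Rightarrow> (nat \<Rightarrow> nat \<Rightarrow> bool) \<Rightarrow> bool" where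
  "iso_rel R S \<longleftrightarrow> (\<exists>\<pi>. bij \<pi> \<and> (\<forall>x y. R x y \<longleftrightarrow> S (\<pi> x) (\<pi> y)))"

definition col_spo :: "(nat \<Rightarrow> nat \<Rightarrow> bool) \<Rightarrow> (nat \<Rightarrow> nat) \<Rightarrow> bool" where
  "col_spo lt c \<longleftrightarrow> (\<forall>x. \<not> lt x x) \<and> (\<forall>x y z. lt x y \<and> lt y z \<longrightarrow> lt x z)
                   \<and> (\<forall>x. c x < 3)"

text \<open>Extension property of the Fraisse limit of finite 3-coloured partial orders:
  every consistent one-point extension of a finite substructure is realised.\<close>
definition generic_ext :: "(nat \<Rightarrow> nat \<Rightarrow> bool) \<Rightarrow> (nat \<Rightarrow> nat) \<Rightarrow> bool" where
  "generic_ext lt c \<longleftrightarrow>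
     (\<forall>A D U k. finite A \<and> D \<subseteq> A \<and> U \<subseteq> A \<and> D \<inter> U = {} \<and> k < 3
        \<and> (\<forall>a\<in>D. \<forall>b\<in>A. lt b a \<longrightarrow> b \<in> D)
        \<and> (\<forall>a\<in>U. \<forall>b\<in>A. lt a b \<longrightarrow> b \<in> U)
        \<and> (\<forall>d\<in>D. \<forall>u\<in>U. lt d u)
      \<longrightarrow> (\<exists>z. z \<notin> A \<and> c z = k \<and> (\<forall>a\<in>A. (lt a z \<longleftrightarrow> a \<in> D) \<and> (lt z a \<longleftrightarrow> a \<in> U))))"

definition generic_3col_po :: "(nat \<Rightarrow> nat \<Rightarrow> bool) \<Rightarrow> (nat \<Rightarrow> nat) \<Rightarrow> bool" where
  "generic_3col_po lt c \<longleftrightarrow> col_spo lt c \<and> generic_ext lt c"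

definition incomp :: "(nat \<Rightarrow> nat \<Rightarrow> bool) \<Rightarrow> nat \<Rightarrow> nat \<Rightarrow> bool" where
  "incomp lt x y \<longleftrightarrow> x \<noteq> y \<and> \<not> lt x y \<and> \<not> lt y x"

definition shuffle_edge :: "(nat \<Rightarrow> nat \<Rightarrow> bool) \<Rightarrow> (nat \<Rightarrow> nat) \<Rightarrow> nat \<Rightarrow> nat \<Rightarrow> bool" where
  "shuffle_edge lt c x y =
     (if c x = c y then lt x y
      else if c y = (c x + 1) mod 3 then lt y x
      else incomp lt y x)"

definition digraph_aut :: "(nat \<Rightarrow> nat \<Rightarrow> bool) \<Rightarrow> (nat \<Rightarrow> nat) set" where
  "digraph_aut E = {\<sigma>. bij \<sigma> \<and> (\<forall>x y. E x y \<longleftrightarrow> E (\<sigma> x) (\<sigma> y))}"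

definition conjugate_in :: "(nat \<Rightarrow> nat) set \<Rightarrow> (nat \<Rightarrow> nat) \<Rightarrow> (nat \<Rightarrow> nat) \<Rightarrow> bool" where
  "conjugate_in G \<phi> \<psi> \<longleftrightarrow> (\<exists>\<alpha>\<in>G. \<alpha> \<circ> \<phi> \<circ> inv \<alpha> = \<psi>)"

end

theory Submission
  imports Defs
begin

text \<open>A partial order \<open>R\<close> is placed in colour class 0 and freely extended to a generic three-coloured
  partial order carrying an automorphism whose fixed points are exactly the points of \<open>R\<close>. The extension
  is functorial, and a least-witness back-and-forth identifies it with the given generic order in a
  Borel way, so isomorphic orders yield conjugate automorphisms. Conversely, the digraph induced on
  the fixed points recovers \<open>R\<close>. Every countable structure is coded by a partial order, and an
  automorphism is classified by the expansion of the digraph by its graph.\<close>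

section \<open>Borel maps between coding spaces\<close>

text \<open>The difficulty is uniformity: the extension and its automorphism must depend on
  \<open>R\<close> both measurably and invariantly. The added points are therefore pure syntax.
  Terms do not mention \<open>R\<close>, so one enumeration serves all orders, and whether one term
  lies below another is decided by finitely many values of \<open>R\<close>. The integer inside each
  added term supplies the automorphism: raising all these integers by one moves exactly the added
  points and commutes with the relabelling of terms induced by an isomorphism from \<open>R\<close>
  to \<open>S\<close>. Transported to the given generic order, this commutation is the required
  conjugacy.\<close>

lemma space_cyl_space [simp]: "space cyl_space = UNIV"
  by (simp add: cyl_space_def space_PiM)

lemma space_rel2_space [simp]: "space rel2_space = UNIV"
  by (simp add: rel2_space_def space_PiM)

lemma measurable_cyl_spaceI:
  assumes "\<And>i. (\<lambda>x. f x i) \<in> measurable M (count_space UNIV)"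
  shows "f \<in> measurable M cyl_space"
  unfolding cyl_space_def using assms by (intro measurable_PiM_single') auto

lemma measurable_rel2_spaceI:
  assumes "\<And>i j. (\<lambda>x. f x i j) \<in> measurable M (count_space UNIV)"
  shows "f \<in> measurable M rel2_space"
  unfolding rel2_space_def
  using assms by (intro measurable_PiM_single' measurable_cyl_spaceI) auto

lemma measurable_cyl_space_apply [measurable]:
  "(\<lambda>f. f i) \<in> measurable cyl_space (count_space UNIV)"
  unfolding cyl_space_def by (rule measurable_component_singleton) simp

lemma measurable_rel2_space_apply [measurable]:
  "(\<lambda>R. R i j) \<in> measurable rel2_space (count_space UNIV)"
proof -
  have "(\<lambda>R. R i) \<in> measurable rel2_space cyl_space"
    unfolding rel2_space_def by (rule measurable_component_singleton) simp
  from measurable_compose[OF this measurable_cyl_space_apply] show ?thesis .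
qed

lemma borel_reducibleI:
  assumes "f \<in> measurable (restrict_space M X) N"
    and "\<And>x. x \<in> X \<Longrightarrow> f x \<in> Y"
    and "\<And>x x'. x \<in> X \<Longrightarrow> x' \<in> X \<Longrightarrow> E x x' \<longleftrightarrow> F (f x) (f x')"
  shows "borel_reducible M X E N Y F"
  unfolding borel_reducible_def
proof (intro bexI ballI)
  show "f \<in> measurable (restrict_space M X) (restrict_space N Y)"
    using assms(1,2) by (intro measurable_restrict_space2) (auto simp: space_restrict_space)
qed (use assms(3) in auto)

lemma borel_reducible_trans:
  assumes "borel_reducible M X E N Y F" "borel_reducible N Y F K Z G" "X \<subseteq> space M"
  shows "borel_reducible M X E K Z G"
proof -
  obtain f g where f: "f \<in> measurable (restrict_space M X) (restrict_space N Y)"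
      "\<And>x x'. x \<in> X \<Longrightarrow> x' \<in> X \<Longrightarrow> E x x' \<longleftrightarrow> F (f x) (f x')"
    and g: "g \<in> measurable (restrict_space N Y) (restrict_space K Z)"
      "\<And>y y'. y \<in> Y \<Longrightarrow> y' \<in> Y \<Longrightarrow> F y y' \<longleftrightarrow> G (g y) (g y')"
    using assms(1,2) unfolding borel_reducible_def by metis
  \<comment> \<open>The restricted space consists of \<open>X \<inter> space M\<close>, so the
    inclusion of \<open>X\<close> in \<open>space M\<close> makes every point of \<open>X\<close>
    available.\<close>
  have "f x \<in> Y" if "x \<in> X" for x
    using measurable_space[OF f(1), of x] that assms(3) by (auto simp: space_restrict_space)
  then show ?thesis
    unfolding borel_reducible_def using f(2) g(2)
    by (intro bexI[OF _ measurable_compose[OF f(1) g(1)]]) simp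
qed

section \<open>Back and forth between generic coloured orders\<close>

definition bf_ok where
  "bf_ok l1 c1 l2 c2 s x y \<longleftrightarrow> c1 x = (c2 y :: nat) \<and>
     (\<forall>(a, b) \<in> set s. b \<noteq> y \<and> (l1 a x \<longleftrightarrow> l2 b y) \<and> (l1 x a \<longleftrightarrow> l2 y b))"

text \<open>Taking the least witness removes all choice, which is what makes the final isomorphism
  measurable in the two orders.\<close>

definition bf_ext ::
  "(nat \<Rightarrow> nat \<Rightarrow> bool) \<Rightarrow> (nat \<Rightarrow> nat) \<Rightarrow> (nat \<Rightarrow> nat \<Rightarrow> bool) \<Rightarrow> (nat \<Rightarrow> nat) \<Rightarrow>
   (nat \<times> nat) list \<Rightarrow> nat \<Rightarrow> (nat \<times> nat) list" where
  "bf_ext l1 c1 l2 c2 s x =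
     (if x \<in> fst ` set s then s else (x, LEAST y. bf_ok l1 c1 l2 c2 s x y) # s)"

text \<open>Stage \<open>n\<close> puts \<open>n\<close> first into the domain and then, with the
  two sides swapped, into the range. Stages are lists so that they range over a countable
  type.\<close>

primrec bf_seq where
  "bf_seq l1 c1 l2 c2 0 = []"
| "bf_seq l1 c1 l2 c2 (Suc n) =
     map prod.swap (bf_ext l2 c2 l1 c1 (map prod.swap (bf_ext l1 c1 l2 c2 (bf_seq l1 c1 l2 c2 n) n)) n)"

definition bf_rel where
  "bf_rel l1 c1 l2 c2 = (\<Union>n. set (bf_seq l1 c1 l2 c2 n))"

definition partial_iso ::
  "(nat \<Rightarrow> nat \<Rightarrow> bool) \<Rightarrow> (nat \<Rightarrow> nat) \<Rightarrow> (nat \<Rightarrow> nat \<Rightarrow> bool) \<Rightarrow> (nat \<Rightarrow> nat) \<Rightarrow>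
   (nat \<times> nat) set \<Rightarrow> bool" where
  "partial_iso l1 c1 l2 c2 s \<longleftrightarrow>
     (\<forall>a b a' b'. (a, b) \<in> s \<longrightarrow> (a', b') \<in> s \<longrightarrow>
        c1 a = c2 b \<and> (a = a' \<longleftrightarrow> b = b') \<and> (l1 a a' \<longleftrightarrow> l2 b b'))"

lemma partial_iso_swap:
  "partial_iso l2 c2 l1 c1 (prod.swap ` s) \<longleftrightarrow> partial_iso l1 c1 l2 c2 s"
  unfolding partial_iso_def pair_in_swap_image
  by (rule iffI; intro allI impI; drule spec, drule spec, drule spec, drule spec,
      drule mp, assumption, drule mp, assumption; simp)

lemma generic_extD:
  assumes "generic_ext lt c" "finite A" "D \<subseteq> A" "U \<subseteq> A" "D \<inter> U = {}" "k < 3"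
    "\<forall>a\<in>D. \<forall>b\<in>A. lt b a \<longrightarrow> b \<in> D" "\<forall>a\<in>U. \<forall>b\<in>A. lt a b \<longrightarrow> b \<in> U" "\<forall>d\<in>D. \<forall>u\<in>U. lt d u"
  shows "\<exists>z. z \<notin> A \<and> c z = k \<and> (\<forall>a\<in>A. (lt a z \<longleftrightarrow> a \<in> D) \<and> (lt z a \<longleftrightarrow> a \<in> U))"
  by (rule assms(1)[unfolded generic_ext_def, THEN spec, THEN spec, THEN spec, THEN spec, THEN mp])
    (intro conjI assms(2-))

text \<open>The images of the points below and above \<open>x\<close> form an admissible pair for
  the extension property: each of its conditions is a comparison in \<open>l1\<close> that follows
  by transitivity, through \<open>x\<close> or to and from it, and is carried over by the partial
  isomorphism.\<close>

lemma bf_ok_exists: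
  assumes s: "partial_iso l1 c1 l2 c2 (set s)" and 1: "col_spo l1 c1" and 2: "generic_3col_po l2 c2"
    and x: "x \<notin> fst ` set s"
  shows "\<exists>y. bf_ok l1 c1 l2 c2 s x y"
proof -
  define A where "A = snd ` set s"
  define D where "D = {b. \<exists>a. (a, b) \<in> set s \<and> l1 a x}"
  define U where "U = {b. \<exists>a. (a, b) \<in> set s \<and> l1 x a}"
  have trans: "l1 u w" if "l1 u v" "l1 v w" for u v w
    using 1 that unfolding col_spo_def by blast
  have irrefl: "\<not> l1 u u" for u
    using 1 unfolding col_spo_def by blast
  have iso: "a = a' \<longleftrightarrow> b = b'" "l1 a a' \<longleftrightarrow> l2 b b'" if "(a, b) \<in> set s" "(a', b') \<in> set s" for a b a' b'
    using s that unfolding partial_iso_def by blast+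
  have col: "c1 x < 3"
    using 1 unfolding col_spo_def by blast
  have sub: "finite A" "D \<subseteq> A" "U \<subseteq> A"
    by (force simp: A_def D_def U_def)+
  have disj: "D \<inter> U = {}"
  proof -
    have False if "(a, b) \<in> set s" "l1 a x" "(a', b) \<in> set s" "l1 x a'" for a a' b
      using iso(1)[OF that(1,3)] trans[OF that(2,4)] irrefl by simp
    then show ?thesis
      unfolding D_def U_def by blast
  qed
  have down: "\<forall>a\<in>D. \<forall>b\<in>A. l2 b a \<longrightarrow> b \<in> D"
  proof (intro ballI impI)
    fix a b assume *: "a \<in> D" "b \<in> A" "l2 b a"
    then obtain a' b' where "(a', a) \<in> set s" "l1 a' x" "(b', b) \<in> set s"
      unfolding A_def D_def by auto
    then show "b \<in> D"
      using * iso(2)[of b' b a' a] trans[of b' a' x] unfolding D_def by blast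
  qed
  have up: "\<forall>a\<in>U. \<forall>b\<in>A. l2 a b \<longrightarrow> b \<in> U"
  proof (intro ballI impI)
    fix a b assume *: "a \<in> U" "b \<in> A" "l2 a b"
    then obtain a' b' where "(a', a) \<in> set s" "l1 x a'" "(b', b) \<in> set s"
      unfolding A_def U_def by auto
    then show "b \<in> U"
      using * iso(2)[of a' a b' b] trans[of x a' b'] unfolding U_def by blast
  qed
  have "l2 b b'" if "(a, b) \<in> set s" "l1 a x" "(a', b') \<in> set s" "l1 x a'" for a b a' b'
    using iso(2)[OF that(1,3)] trans[OF that(2,4)] by simp
  then have "\<forall>d\<in>D. \<forall>u\<in>U. l2 d u"
    unfolding D_def U_def by blast
  moreover have "generic_ext l2 c2"
    using 2 by (simp add: generic_3col_po_def)
  ultimately obtain z where z: "z \<notin> A" "c2 z = c1 x"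
      "\<forall>a\<in>A. (l2 a z \<longleftrightarrow> a \<in> D) \<and> (l2 z a \<longleftrightarrow> a \<in> U)"
    using generic_extD[OF _ sub disj col down up] by blast
  have "b \<noteq> z \<and> (l1 a x \<longleftrightarrow> l2 b z) \<and> (l1 x a \<longleftrightarrow> l2 z b)" if ab: "(a, b) \<in> set s" for a b
  proof -
    have "b \<in> A" using ab unfolding A_def by force
    moreover have "b \<in> D \<longleftrightarrow> l1 a x" "b \<in> U \<longleftrightarrow> l1 x a"
      using ab iso(1) unfolding D_def U_def by blast+
    ultimately show ?thesis using z by auto
  qed
  then show ?thesis
    using z(2) unfolding bf_ok_def by (intro exI[of _ z]) auto
qed

lemma bf_ext_partial_iso:
  assumes s: "partial_iso l1 c1 l2 c2 (set s)" and 1: "col_spo l1 c1" and 2: "generic_3col_po l2 c2"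
  shows "partial_iso l1 c1 l2 c2 (set (bf_ext l1 c1 l2 c2 s x))"
proof (cases "x \<in> fst ` set s")
  case False
  define y where "y = (LEAST y. bf_ok l1 c1 l2 c2 s x y)"
  have ok: "bf_ok l1 c1 l2 c2 s x y"
    using LeastI_ex[OF bf_ok_exists[OF assms False]] by (simp add: y_def)
  have irrefl: "\<not> l1 x x" "\<not> l2 y y"
    using 1 2 unfolding col_spo_def generic_3col_po_def by blast+
  have xy: "c1 x = c2 y"
    "\<And>a b. (a, b) \<in> set s \<Longrightarrow> a \<noteq> x \<and> b \<noteq> y \<and> (l1 a x \<longleftrightarrow> l2 b y) \<and> (l1 x a \<longleftrightarrow> l2 y b)"
    using ok False unfolding bf_ok_def by force+
  have old: "c1 a = c2 b \<and> (a = a' \<longleftrightarrow> b = b') \<and> (l1 a a' \<longleftrightarrow> l2 b b')"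
    if "(a, b) \<in> set s" "(a', b') \<in> set s" for a b a' b'
    using s that unfolding partial_iso_def by blast
  have "set (bf_ext l1 c1 l2 c2 s x) = insert (x, y) (set s)"
    using False by (simp add: bf_ext_def y_def)
  then show ?thesis
    unfolding partial_iso_def using xy old irrefl by simp metis
qed (use s in \<open>simp add: bf_ext_def\<close>)

lemma bf_ext_mono: "set s \<subseteq> set (bf_ext l1 c1 l2 c2 s x)"
  by (auto simp: bf_ext_def)

lemma bf_ext_dom: "x \<in> fst ` set (bf_ext l1 c1 l2 c2 s x)"
  by (auto simp: bf_ext_def)

context
  fixes l1 c1 l2 c2
  assumes g1: "generic_3col_po l1 c1" and g2: "generic_3col_po l2 c2"
begin

lemma bf_seq_partial_iso: "partial_iso l1 c1 l2 c2 (set (bf_seq l1 c1 l2 c2 n))"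
proof (induction n)
  case (Suc n)
  have "col_spo l1 c1" "col_spo l2 c2"
    using g1 g2 by (auto simp: generic_3col_po_def)
  then show ?case
    using Suc g1 g2 by (simp add: partial_iso_swap bf_ext_partial_iso)
qed (simp add: partial_iso_def)

lemma bf_seq_step:
  "set (bf_ext l1 c1 l2 c2 (bf_seq l1 c1 l2 c2 n) n) \<subseteq> set (bf_seq l1 c1 l2 c2 (Suc n))"
  using bf_ext_mono[of "map prod.swap (bf_ext l1 c1 l2 c2 (bf_seq l1 c1 l2 c2 n) n)" l2 c2 l1 c1 n]
  by force

lemma bf_seq_mono: "m \<le> n \<Longrightarrow> set (bf_seq l1 c1 l2 c2 m) \<subseteq> set (bf_seq l1 c1 l2 c2 n)"
  by (rule lift_Suc_mono_le[of "\<lambda>n. set (bf_seq l1 c1 l2 c2 n)"])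
    (rule order_trans[OF bf_ext_mono bf_seq_step])

lemma bf_rel_partial_iso: "partial_iso l1 c1 l2 c2 (bf_rel l1 c1 l2 c2)"
proof -
  have *: "c1 a = c2 b \<and> (a = a' \<longleftrightarrow> b = b') \<and> (l1 a a' \<longleftrightarrow> l2 b b')"
    if ab: "(a, b) \<in> bf_rel l1 c1 l2 c2" "(a', b') \<in> bf_rel l1 c1 l2 c2" for a b a' b'
  proof -
    obtain m n where "(a, b) \<in> set (bf_seq l1 c1 l2 c2 m)" "(a', b') \<in> set (bf_seq l1 c1 l2 c2 n)"
      using ab unfolding bf_rel_def by auto
    then have "(a, b) \<in> set (bf_seq l1 c1 l2 c2 (max m n))" "(a', b') \<in> set (bf_seq l1 c1 l2 c2 (max m n))"
      using bf_seq_mono[of m "max m n"] bf_seq_mono[of n "max m n"] by auto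
    then show ?thesis
      using bf_seq_partial_iso[of "max m n"] unfolding partial_iso_def by blast
  qed
  then show ?thesis
    unfolding partial_iso_def by blast
qed

text \<open>The graph of \<open>g\<close> is named explicitly because measurability is available for
  \<open>bf_rel\<close>, not for an isomorphism that is merely known to exist.\<close>

lemma bf_rel_iso:
  "\<exists>g. bij g \<and> (\<forall>x y. g x = y \<longleftrightarrow> (x, y) \<in> bf_rel l1 c1 l2 c2) \<and>
     (\<forall>x. c2 (g x) = c1 x) \<and> (\<forall>x y. l2 (g x) (g y) \<longleftrightarrow> l1 x y)"
proof -
  let ?r = "bf_rel l1 c1 l2 c2"
  have iso: "c1 a = c2 b" "a = a' \<longleftrightarrow> b = b'" "l1 a a' \<longleftrightarrow> l2 b b'"
    if "(a, b) \<in> ?r" "(a', b') \<in> ?r" for a b a' b'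
    using bf_rel_partial_iso that unfolding partial_iso_def by blast+
  have "\<exists>y. (x, y) \<in> ?r" for x
  proof -
    obtain y where "(x, y) \<in> set (bf_ext l1 c1 l2 c2 (bf_seq l1 c1 l2 c2 x) x)"
      using bf_ext_dom[of x l1 c1 l2 c2 "bf_seq l1 c1 l2 c2 x"] by auto
    then show ?thesis
      using bf_seq_step[of x] unfolding bf_rel_def by blast
  qed
  then obtain g where g: "\<And>x. (x, g x) \<in> ?r"
    by metis
  have surj: "\<exists>x. (x, y) \<in> ?r" for y
  proof -
    let ?s = "map prod.swap (bf_ext l1 c1 l2 c2 (bf_seq l1 c1 l2 c2 y) y)"
    obtain x where "(y, x) \<in> set (bf_ext l2 c2 l1 c1 ?s y)"
      using bf_ext_dom[of y l2 c2 l1 c1 ?s] by auto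
    then have "(x, y) \<in> set (bf_seq l1 c1 l2 c2 (Suc y))"
      by simp
    then show ?thesis
      unfolding bf_rel_def by blast
  qed
  have g_iff: "g x = y \<longleftrightarrow> (x, y) \<in> ?r" for x y
    using g[of x] iso(2)[OF g[of x], of x y] by auto
  have "inj g"
    using iso(2)[OF g g] by (auto intro!: injI)
  moreover have "surj g"
    using surj g_iff by (metis surj_def)
  ultimately have "bij g"
    by (rule bijI)
  then show ?thesis
    using g_iff iso(1,3)[OF g g] by (intro exI[of _ g]) auto
qed

end

section \<open>Measurable dependence of the back-and-forth on the orders\<close>

lemma bf_ext_measurable:
  assumes "\<And>a b. Measurable.pred M (\<lambda>x. L x a b)" "\<And>a b. Measurable.pred M (\<lambda>x. L' x a b)"
  shows "(\<lambda>x. bf_ext (L x) c1 (L' x) c2 s n) \<in> measurable M (count_space UNIV)"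
proof -
  note [measurable] = assms
  have "Measurable.pred M (\<lambda>x. bf_ok (L x) c1 (L' x) c2 s n y)" for y
    unfolding bf_ok_def split_beta by measurable
  then have "(\<lambda>x. LEAST y. bf_ok (L x) c1 (L' x) c2 s n y) \<in> measurable M (count_space UNIV)"
    by (rule measurable_Least)
  then show ?thesis
    unfolding bf_ext_def by (cases "n \<in> fst ` set s") (auto intro: measurable_compose)
qed

lemma bf_seq_measurable:
  assumes L: "\<And>a b. Measurable.pred M (\<lambda>x. L x a b)" and L': "\<And>a b. Measurable.pred M (\<lambda>x. L' x a b)"
  shows "(\<lambda>x. bf_seq (L x) c1 (L' x) c2 n) \<in> measurable M (count_space UNIV)"
proof (induction n)
  case (Suc n)
  let ?s = "\<lambda>x. bf_ext (L x) c1 (L' x) c2 (bf_seq (L x) c1 (L' x) c2 n) n"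
  \<comment> \<open>The previous stage takes countably many values, so it suffices to treat each
    fixed list \<open>s\<close> separately.\<close>
  have "?s \<in> measurable M (count_space UNIV)"
    by (rule measurable_compose_countable[OF _ Suc]) (intro bf_ext_measurable assms)
  then have "(\<lambda>x. bf_ext (L' x) c2 (L x) c1 (map prod.swap (?s x)) n) \<in> measurable M (count_space UNIV)"
    by (rule measurable_compose_countable[rotated]) (intro bf_ext_measurable assms)
  then show ?case
    unfolding bf_seq.simps by (rule measurable_compose) (rule measurable_count_space)
qed simp

lemma bf_rel_measurable:
  assumes "\<And>a b. Measurable.pred M (\<lambda>x. L x a b)" "\<And>a b. Measurable.pred M (\<lambda>x. L' x a b)"
  shows "Measurable.pred M (\<lambda>x. (a, b) \<in> bf_rel (L x) c1 (L' x) c2)"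
proof -
  have "Measurable.pred M (\<lambda>x. (a, b) \<in> set (bf_seq (L x) c1 (L' x) c2 n))" for n
    by (rule measurable_compose[OF bf_seq_measurable[OF assms]])
      (rule measurable_count_space)
  then show ?thesis
    unfolding bf_rel_def UN_iff by measurable
qed

section \<open>The free generic extension of a partial order\<close>

text \<open>\<open>New D U k m\<close> is the free point of colour \<open>k mod 3\<close> above \<open>D\<close> and below \<open>U\<close>; it is isolated
  at its creation when \<open>D < U\<close> fails, so that the set of points does not depend on the order.
  Taking \<open>k\<close> large makes it larger than any given finite set of terms, and shifting \<open>m\<close>
  moves it along an infinite orbit.\<close>

datatype ext_term = Base nat | New "ext_term list" "ext_term list" nat int

instance ext_term :: countable
  by countable_datatype

primrec colour :: "ext_term \<Rightarrow> nat" where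
  "colour (Base p) = 0"
| "colour (New D U k m) = k mod 3"

text \<open>Instead of a transitivity rule, each rule passes from an added point to one of its own
  defining points. Every premise then concerns a pair of smaller total size, and since all premises
  are positive, derivations can be transported along maps of terms.\<close>

inductive tlt :: "(nat \<Rightarrow> nat \<Rightarrow> bool) \<Rightarrow> ext_term \<Rightarrow> ext_term \<Rightarrow> bool" for R where
  base: "R p q \<Longrightarrow> p \<noteq> q \<Longrightarrow> tlt R (Base p) (Base q)"
| upper: "\<forall>d\<in>set D. \<forall>u\<in>set U. tlt R d u \<Longrightarrow> u \<in> set U \<Longrightarrow> u = y \<or> tlt R u y \<Longrightarrow> tlt R (New D U k m) y"
| lower: "\<forall>d\<in>set D. \<forall>u\<in>set U. tlt R d u \<Longrightarrow> d \<in> set D \<Longrightarrow> x = d \<or> tlt R x d \<Longrightarrow> tlt R x (New D U k m)"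

text \<open>Sums rather than maxima, so that a lower and an upper defining point together are still
  smaller than the new point. Counting \<open>k\<close> gives arbitrarily large points over the same
  \<open>D\<close> and \<open>U\<close>.\<close>

primrec tsize :: "ext_term \<Rightarrow> nat" where
  "tsize (Base p) = 0"
| "tsize (New D U k m) = Suc (sum_list (map tsize D) + sum_list (map tsize U) + k)"

lemma tsize_New:
  "d \<in> set D \<Longrightarrow> tsize d < tsize (New D U k m)"
  "u \<in> set U \<Longrightarrow> tsize u < tsize (New D U k m)"
  "d \<in> set D \<Longrightarrow> u \<in> set U \<Longrightarrow> tsize d + tsize u < tsize (New D U k m)"
  "k < tsize (New D U k m)"
proof -
  have *: "d \<in> set X \<Longrightarrow> tsize d \<le> sum_list (map tsize X)" for d :: ext_term and X
    by (rule member_le_sum_list) auto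
  show "d \<in> set D \<Longrightarrow> tsize d < tsize (New D U k m)"
    "u \<in> set U \<Longrightarrow> tsize u < tsize (New D U k m)"
    "d \<in> set D \<Longrightarrow> u \<in> set U \<Longrightarrow> tsize d + tsize u < tsize (New D U k m)"
    "k < tsize (New D U k m)"
    using *[of d D] *[of u U] by auto
qed

declare tsize.simps [simp del]

text \<open>Induction on the total size of the triple. The decisive case has \<open>y\<close> new,
  with \<open>x\<close> at or below some \<open>d\<close> and \<open>z\<close> at or above some
  \<open>u\<close>: the validity premise gives \<open>d\<close> below \<open>u\<close>, and the
  detour through \<open>d\<close> and \<open>u\<close> replaces \<open>y\<close> by smaller
  points.\<close>

lemma tlt_trans:
  assumes R: "R \<in> posets" and "tlt R x y" "tlt R y z"
  shows "tlt R x z"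
  using assms(2,3)
proof (induction "tsize x + tsize y + tsize z" arbitrary: x y z rule: less_induct)
  case less
  have via_lower: ?case if "z = New D U k m" "d \<in> set D" "y = d \<or> tlt R y d"
      "\<forall>d\<in>set D. \<forall>u\<in>set U. tlt R d u" for D U k m d
  proof -
    have "tlt R x d"
      using that(3)
    proof
      assume "tlt R y d"
      then show ?thesis
        using tsize_New(1)[OF that(2), of U k m] less.prems(1) that(1)
        by (intro less.hyps[of x y d]) auto
    qed (use less.prems(1) in simp)
    then show ?thesis
      unfolding that(1) using that by (intro tlt.lower[where d = d]) auto
  qed
  show ?case
    using less.prems(1)
  proof cases
    case xy: (base p q)
    show ?thesis
      using less.prems(2)
    proof cases
      case yz: (base p' q')
      then have pq: "R p q" "R q q'" "p \<noteq> q"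
        using xy by auto
      then have "R p q'" "p \<noteq> q'"
        using R unfolding posets_def by blast+
      then show ?thesis
        using xy yz by (simp add: tlt.base)
    qed (use xy via_lower in auto)
  next
    case (upper D U u k m)
    from upper(4) have "tlt R u z"
    proof
      assume "tlt R u y"
      then show ?thesis
        using tsize_New(2)[OF upper(3), of D k m] less.prems(2) upper(1)
        by (intro less.hyps[of u y z]) auto
    qed (use less.prems(2) in simp)
    then show ?thesis
      unfolding upper(1) using upper by (intro tlt.upper[where u = u]) auto
  next
    case xy: (lower D U d k m)
    show ?thesis
      using less.prems(2)
    proof cases
      case (upper D' U' u k' m')
      then have u: "u \<in> set U" "tlt R d u"
        using xy by auto
      note size = tsize_New(3)[OF xy(3) u(1), of k m] tsize_New(2)[OF u(1), of D k m]
      from xy(4) have "tlt R x u"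
      proof
        assume "tlt R x d"
        then show ?thesis
          using size u xy(1) by (intro less.hyps[of x d u]) auto
      qed (use u in simp)
      with upper(4) show ?thesis
      proof (elim disjE)
        assume "tlt R u z"
        with \<open>tlt R x u\<close> show ?thesis
          using size xy(1) by (intro less.hyps[of x u z]) auto
      qed simp
    qed (use xy via_lower in auto)
  qed
qed

text \<open>A loop at a new point runs through one of its defining points, which by transitivity
  would be a smaller loop.\<close>

lemma tlt_irrefl:
  assumes "R \<in> posets"
  shows "\<not> tlt R x x"
proof (induction "tsize x" arbitrary: x rule: less_induct)
  case less
  show ?case
  proof
    assume x: "tlt R x x"
    have no_pair: False if "tsize w < tsize x" "w = x \<or> (tlt R w x \<and> tlt R x w)" for w
      using that less[of w] tlt_trans[OF assms, of w x w] by auto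
    from x show False
    proof cases
      case (upper D U u k m)
      then have "tlt R x u"
        by (auto intro: tlt.upper[where u = u])
      then show False
        using upper no_pair[of u] tsize_New(2)[of u U D k m] by auto
    next
      case (lower D U d k m)
      then have "tlt R d x"
        by (auto intro: tlt.lower[where d = d])
      then show False
        using lower no_pair[of d] tsize_New(1)[of d D U k m] by auto
    qed auto
  qed
qed

text \<open>The size bound matters: larger terms may be placed below \<open>New D U k m\<close>
  without lying below any point of \<open>D\<close>. For a smaller \<open>a\<close>, a derivation
  through an upper point of \<open>a\<close> leads to a still smaller term.\<close>

lemma tlt_New_right:
  assumes "R \<in> posets" "tlt R a (New D U k m)" "tsize a < tsize (New D U k m)"
  shows "\<exists>d\<in>set D. a = d \<or> tlt R a d"
  using assms(2,3)
proof (induction "tsize a" arbitrary: a rule: less_induct)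
  case less
  show ?case
    using less.prems(1)
  proof cases
    case (upper D' U' u k' m')
    then have u: "tsize u < tsize a" "tlt R a u"
      using tsize_New(2)[of u U' D' k' m'] by (auto intro: tlt.upper[where u = u])
    then have "\<exists>d\<in>set D. u = d \<or> tlt R u d"
      using less.hyps[of u] less.prems(2) upper(4) by auto
    then show ?thesis
      using u(2) tlt_trans[OF assms(1) u(2)] by blast
  qed auto
qed

lemma tlt_New_left:
  assumes "R \<in> posets" "tlt R (New D U k m) a" "tsize a < tsize (New D U k m)"
  shows "\<exists>u\<in>set U. u = a \<or> tlt R u a"
  using assms(2,3)
proof (induction "tsize a" arbitrary: a rule: less_induct)
  case less
  show ?case
    using less.prems(1)
  proof cases
    case (lower D' U' d k' m')
    then have d: "tsize d < tsize a" "tlt R d a"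
      using tsize_New(1)[of d D' U' k' m'] by (auto intro: tlt.lower[where d = d])
    then have "\<exists>u\<in>set U. u = d \<or> tlt R u d"
      using less.hyps[of d] less.prems(2) lower(4) by auto
    then show ?thesis
      using d(2) tlt_trans[OF assms(1) _ d(2)] by blast
  qed auto
qed

text \<open>The witness is the free point over \<open>D\<close> and \<open>U\<close>, made larger
  than all of \<open>A\<close>. Its relations to \<open>A\<close> then go through \<open>D\<close>
  and \<open>U\<close>, and the closure conditions on these sets turn comparability into
  membership.\<close>

lemma tlt_extension:
  assumes R: "R \<in> posets" and "finite A" "D \<subseteq> A" "U \<subseteq> A" "k < 3"
    and down: "\<forall>a\<in>D. \<forall>b\<in>A. tlt R b a \<longrightarrow> b \<in> D"
    and up: "\<forall>a\<in>U. \<forall>b\<in>A. tlt R a b \<longrightarrow> b \<in> U"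
    and DU: "\<forall>d\<in>D. \<forall>u\<in>U. tlt R d u"
  shows "\<exists>z. z \<notin> A \<and> colour z = k \<and> (\<forall>a\<in>A. (tlt R a z \<longleftrightarrow> a \<in> D) \<and> (tlt R z a \<longleftrightarrow> a \<in> U))"
proof -
  have "finite D" "finite U"
    using assms finite_subset by blast+
  then obtain Dl Ul where l: "set Dl = D" "set Ul = U"
    using finite_list by metis
  define N where "N = Max (insert 0 (tsize ` A))"
  \<comment> \<open>A multiple of 3 enlarges \<open>z\<close> beyond the maximal size
    \<open>N\<close> without changing its colour.\<close>
  define z where "z = New Dl Ul (k + 3 * N) 0"
  have size: "tsize a < tsize z" if "a \<in> A" for a
  proof -
    have "tsize a \<le> N"
      unfolding N_def using that \<open>finite A\<close> by (intro Max_ge) auto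
    then show ?thesis
      using tsize_New(4)[of "k + 3 * N" Dl Ul 0] unfolding z_def by linarith
  qed
  have "tlt R a z \<longleftrightarrow> a \<in> D" "tlt R z a \<longleftrightarrow> a \<in> U" if "a \<in> A" for a
  proof -
    have "tlt R a z" if "a \<in> D"
      unfolding z_def using that l DU by (intro tlt.lower[where d = a]) auto
    moreover have "a \<in> D" if "tlt R a z"
      using tlt_New_right[OF R that[unfolded z_def]] size \<open>a \<in> A\<close> l(1) down
      unfolding z_def by blast
    ultimately show "tlt R a z \<longleftrightarrow> a \<in> D" by blast
    have "tlt R z a" if "a \<in> U"
      unfolding z_def using that l DU by (intro tlt.upper[where u = a]) auto
    moreover have "a \<in> U" if "tlt R z a"
      using tlt_New_left[OF R that[unfolded z_def]] size \<open>a \<in> A\<close> l(2) up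
      unfolding z_def by blast
    ultimately show "tlt R z a \<longleftrightarrow> a \<in> U" by blast
  qed
  moreover have "z \<notin> A"
    using size by blast
  moreover have "colour z = k"
    using \<open>k < 3\<close> by (simp add: z_def)
  ultimately show ?thesis
    by blast
qed

text \<open>For fixed terms the rules unfold, by recursion on size, into a finite Boolean
  combination of conditions \<open>R p q\<close>.\<close>

lemma tlt_measurable: "Measurable.pred rel2_space (\<lambda>R. tlt R s t)"
proof (induction "tsize s + tsize t" arbitrary: s t rule: less_induct)
  case less
  have valid: "Measurable.pred rel2_space (\<lambda>R. \<forall>d\<in>set D. \<forall>u\<in>set U. tlt R d u)"
    if "s = New D U k m \<or> t = New D U k m" for D U k m
  proof (intro pred_intros_finite less)
    fix d u assume "d \<in> set D" "u \<in> set U"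
    then show "tsize d + tsize u < tsize s + tsize t"
      using that tsize_New(3)[of d D u U k m] by (auto)
  qed auto
  have base: "Measurable.pred rel2_space (\<lambda>R. \<exists>p q. s = Base p \<and> t = Base q \<and> R p q \<and> p \<noteq> q)"
    by measurable
  have upper: "Measurable.pred rel2_space (\<lambda>R. \<exists>D U k m. s = New D U k m \<and>
      (\<forall>d\<in>set D. \<forall>u\<in>set U. tlt R d u) \<and> (\<exists>u\<in>set U. u = t \<or> tlt R u t))"
  proof (cases s)
    case (New D U k m)
    have "Measurable.pred rel2_space (\<lambda>R. \<exists>u\<in>set U. u = t \<or> tlt R u t)"
      by (intro pred_intros_finite pred_intros_logic less)
        (use New tsize_New(2) in auto)
    moreover have "Measurable.pred rel2_space (\<lambda>R. \<forall>d\<in>set D. \<forall>u\<in>set U. tlt R d u)"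
      using valid New by blast
    ultimately have "Measurable.pred rel2_space (\<lambda>R. (\<forall>d\<in>set D. \<forall>u\<in>set U. tlt R d u) \<and>
        (\<exists>u\<in>set U. u = t \<or> tlt R u t))"
      by (intro pred_intros_logic)
    then show ?thesis
      using New by simp
  qed auto
  have lower: "Measurable.pred rel2_space (\<lambda>R. \<exists>D U k m. t = New D U k m \<and>
      (\<forall>d\<in>set D. \<forall>u\<in>set U. tlt R d u) \<and> (\<exists>d\<in>set D. s = d \<or> tlt R s d))"
  proof (cases t)
    case (New D U k m)
    have "Measurable.pred rel2_space (\<lambda>R. \<exists>d\<in>set D. s = d \<or> tlt R s d)"
      by (intro pred_intros_finite pred_intros_logic less)
        (use New tsize_New(1) in auto)
    moreover have "Measurable.pred rel2_space (\<lambda>R. \<forall>d\<in>set D. \<forall>u\<in>set U. tlt R d u)"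
      using valid New by blast
    ultimately have "Measurable.pred rel2_space (\<lambda>R. (\<forall>d\<in>set D. \<forall>u\<in>set U. tlt R d u) \<and>
        (\<exists>d\<in>set D. s = d \<or> tlt R s d))"
      by (intro pred_intros_logic)
    then show ?thesis
      using New by simp
  qed auto
  have eq: "(\<lambda>R. tlt R s t) = (\<lambda>R. (\<exists>p q. s = Base p \<and> t = Base q \<and> R p q \<and> p \<noteq> q) \<or>
      (\<exists>D U k m. s = New D U k m \<and> (\<forall>d\<in>set D. \<forall>u\<in>set U. tlt R d u) \<and> (\<exists>u\<in>set U. u = t \<or> tlt R u t)) \<or>
      (\<exists>D U k m. t = New D U k m \<and> (\<forall>d\<in>set D. \<forall>u\<in>set U. tlt R d u) \<and> (\<exists>d\<in>set D. s = d \<or> tlt R s d)))"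
    by (intro ext, subst tlt.simps) blast
  show ?case
    by (subst eq) (rule pred_intros_logic base upper lower)+
qed

section \<open>Functoriality of the extension and the shift\<close>

primrec tmap :: "(nat \<Rightarrow> nat) \<Rightarrow> int \<Rightarrow> ext_term \<Rightarrow> ext_term" where
  "tmap h j (Base p) = Base (h p)"
| "tmap h j (New D U k m) = New (map (tmap h j) D) (map (tmap h j) U) k (m + j)"

text \<open>Base labels and shifts compose independently. This yields inverses, and also the
  commutation of relabelling with the shift.\<close>

lemma tmap_tmap: "tmap h j (tmap h' j' t) = tmap (\<lambda>p. h (h' p)) (j + j') t"
  by (induction t) auto

lemma tmap_id: "tmap (\<lambda>p. p) 0 t = t"
  by (induction t) (auto intro: map_idI)

lemma colour_tmap: "colour (tmap h j t) = colour t"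
  by (cases t) auto

lemma bij_tmap:
  assumes "bij h"
  shows "bij (tmap h j)"
proof (rule o_bij)
  have "inv h (h p) = p" "h (inv h p) = p" for p
    using assms by (simp_all add: bij_is_inj bij_is_surj surj_f_inv_f)
  then show "tmap (inv h) (- j) \<circ> tmap h j = id" "tmap h j \<circ> tmap (inv h) (- j) = id"
    by (auto simp: tmap_tmap tmap_id)
qed

text \<open>The defining lists are moved together with their point, so a derivation is carried over
  rule by rule; injectivity of \<open>h\<close> preserves the side condition
  \<open>p \<noteq> q\<close>.\<close>

lemma tlt_tmap_imp:
  assumes "tlt R s t" "inj h" "\<And>p q. R p q \<Longrightarrow> S (h p) (h q)"
  shows "tlt S (tmap h j s) (tmap h j t)"
  using assms(1)
proof induction
  case (base p q)
  then show ?case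
    using assms(2,3) by (auto intro!: tlt.base dest: injD)
next
  case (upper D U u y k m)
  then show ?case
    by (auto intro!: tlt.upper[where u = "tmap h j u"])
next
  case (lower D U d x k m)
  then show ?case
    by (auto intro!: tlt.lower[where d = "tmap h j d"])
qed

lemma tlt_tmap:
  assumes "bij h" "\<And>p q. R p q \<longleftrightarrow> S (h p) (h q)"
  shows "tlt S (tmap h j s) (tmap h j t) \<longleftrightarrow> tlt R s t"
proof
  have inv: "inv h (h p) = p" "h (inv h p) = p" for p
    using assms(1) by (simp_all add: bij_is_inj bij_is_surj surj_f_inv_f)
  assume "tlt S (tmap h j s) (tmap h j t)"
  then have "tlt R (tmap (inv h) (- j) (tmap h j s)) (tmap (inv h) (- j) (tmap h j t))"
    by (rule tlt_tmap_imp) (use assms inv in \<open>auto simp: bij_imp_bij_inv bij_is_inj\<close>)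
  then show "tlt R s t"
    by (simp add: tmap_tmap inv tmap_id)
qed (use assms in \<open>auto intro: tlt_tmap_imp bij_is_inj\<close>)

lemma tmap_fixed_iff: "tmap (\<lambda>p. p) 1 t = t \<longleftrightarrow> t \<in> range Base"
  by (cases t) auto


section \<open>From partial orders to automorphisms\<close>

definition term_enum :: "nat \<Rightarrow> ext_term" where
  "term_enum = from_nat_into UNIV"

definition gen_lt :: "(nat \<Rightarrow> nat \<Rightarrow> bool) \<Rightarrow> nat \<Rightarrow> nat \<Rightarrow> bool" where
  "gen_lt R x y \<longleftrightarrow> tlt R (term_enum x) (term_enum y)"

definition gen_col :: "nat \<Rightarrow> nat" where
  "gen_col x = colour (term_enum x)"

definition gen_map :: "(nat \<Rightarrow> nat) \<Rightarrow> int \<Rightarrow> nat \<Rightarrow> nat" where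
  "gen_map h j x = inv term_enum (tmap h j (term_enum x))"

lemma bij_term_enum: "bij term_enum"
proof -
  have "infinite (range Base)"
    by (rule range_inj_infinite) (simp add: inj_def)
  then have "infinite (UNIV :: ext_term set)"
    by (rule infinite_super[OF subset_UNIV])
  then show ?thesis
    unfolding term_enum_def by (intro bij_betw_from_nat_into) auto
qed

lemma term_enum_inv [simp]: "term_enum (inv term_enum t) = t"
  by (simp add: bij_term_enum bij_is_surj surj_f_inv_f)

lemma generic_gen_lt:
  assumes "R \<in> posets"
  shows "generic_3col_po (gen_lt R) gen_col"
  unfolding generic_3col_po_def
proof
  have "colour t < 3" for t
    by (cases t) auto
  then show "col_spo (gen_lt R) gen_col"
    using tlt_trans[OF assms] tlt_irrefl[OF assms]
    unfolding col_spo_def gen_lt_def gen_col_def by blast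
  show "generic_ext (gen_lt R) gen_col"
    unfolding generic_ext_def
  proof (intro allI impI, elim conjE)
    fix A D U :: "nat set" and k :: nat
    assume *: "finite A" "D \<subseteq> A" "U \<subseteq> A" "k < 3"
      "\<forall>a\<in>D. \<forall>b\<in>A. gen_lt R b a \<longrightarrow> b \<in> D" "\<forall>a\<in>U. \<forall>b\<in>A. gen_lt R a b \<longrightarrow> b \<in> U"
      "\<forall>d\<in>D. \<forall>u\<in>U. gen_lt R d u"
    have inj: "term_enum x \<in> term_enum ` X \<longleftrightarrow> x \<in> X" for x X
      using bij_term_enum by (simp add: bij_is_inj inj_image_mem_iff)
    have "\<exists>z. z \<notin> term_enum ` A \<and> colour z = k \<and> (\<forall>a\<in>term_enum ` A.
        (tlt R a z \<longleftrightarrow> a \<in> term_enum ` D) \<and> (tlt R z a \<longleftrightarrow> a \<in> term_enum ` U))"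
      by (rule tlt_extension[OF assms], unfold ball_simps(9) inj gen_lt_def[symmetric])
        (intro finite_imageI image_mono *)+
    then obtain z where z: "z \<notin> term_enum ` A" "colour z = k" "\<forall>a\<in>term_enum ` A.
        (tlt R a z \<longleftrightarrow> a \<in> term_enum ` D) \<and> (tlt R z a \<longleftrightarrow> a \<in> term_enum ` U)"
      by blast
    have "inv term_enum z \<notin> A"
      using z(1) inj[of "inv term_enum z" A] by simp
    moreover have "(gen_lt R a (inv term_enum z) \<longleftrightarrow> a \<in> D) \<and> (gen_lt R (inv term_enum z) a \<longleftrightarrow> a \<in> U)"
      if "a \<in> A" for a
      using z(3) that inj[of a D] inj[of a U] unfolding gen_lt_def by simp
    ultimately show "\<exists>z. z \<notin> A \<and> gen_col z = k \<and>
        (\<forall>a\<in>A. (gen_lt R a z \<longleftrightarrow> a \<in> D) \<and> (gen_lt R z a \<longleftrightarrow> a \<in> U))"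
      using z(2) by (intro exI[of _ "inv term_enum z"]) (auto simp: gen_col_def)
  qed
qed

lemma bij_gen_map: "bij h \<Longrightarrow> bij (gen_map h j)"
  using bij_comp[OF bij_comp[OF bij_term_enum bij_tmap] bij_imp_bij_inv[OF bij_term_enum], of h j]
  by (simp add: gen_map_def[abs_def] comp_def)

lemma gen_col_gen_map: "gen_col (gen_map h j x) = gen_col x"
  by (simp add: gen_col_def gen_map_def colour_tmap)

lemma gen_lt_gen_map:
  assumes "bij h" "\<And>p q. R p q \<longleftrightarrow> S (h p) (h q)"
  shows "gen_lt S (gen_map h j x) (gen_map h j y) \<longleftrightarrow> gen_lt R x y"
  using tlt_tmap[of h R S, OF assms] by (simp add: gen_lt_def gen_map_def)

lemma gen_map_fixed_iff: "gen_map (\<lambda>p. p) 1 x = x \<longleftrightarrow> (\<exists>p. x = inv term_enum (Base p))"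
proof -
  have "gen_map (\<lambda>p. p) 1 x = x \<longleftrightarrow> tmap (\<lambda>p. p) 1 (term_enum x) = term_enum x"
    unfolding gen_map_def using bij_term_enum by (metis bij_inv_eq_iff)
  also have "\<dots> \<longleftrightarrow> (\<exists>p. x = inv term_enum (Base p))"
    unfolding tmap_fixed_iff using bij_term_enum by (metis bij_inv_eq_iff rangeE rangeI)
  finally show ?thesis .
qed

lemma gen_lt_Base:
  "gen_lt R (inv term_enum (Base p)) (inv term_enum (Base q)) \<longleftrightarrow> R p q \<and> p \<noteq> q"
  unfolding gen_lt_def by (auto intro: tlt.base elim: tlt.cases)

text \<open>This brings coloured orders into the digraph: conjugators are constructed on the
  coloured side and land in the digraph group.\<close>

lemma shuffle_edge_colour_iso:
  assumes "inj g" "\<And>x. c' (g x) = c x" "\<And>x y. l' (g x) (g y) \<longleftrightarrow> l x y"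
  shows "shuffle_edge l' c' (g x) (g y) \<longleftrightarrow> shuffle_edge l c x y"
  using assms by (simp add: shuffle_edge_def incomp_def inj_eq)

text \<open>An automorphism need not preserve the colour classes, but the fixed points of the
  constructed automorphism all lie in one class, where the edges of the shuffle are the order.
  So the induced digraph on the fixed points is a conjugacy invariant that returns the
  original partial order.\<close>

lemma posets_reducible_conjugacy:
  assumes gen: "generic_3col_po lt c"
  defines "G \<equiv> digraph_aut (shuffle_edge lt c)"
  shows "borel_reducible rel2_space posets iso_rel cyl_space G (conjugate_in G)"
proof -
  define good where "good R g \<longleftrightarrow> bij g \<and>
      (\<forall>x y. g x = y \<longleftrightarrow> (x, y) \<in> bf_rel (gen_lt R) gen_col lt c) \<and>
      (\<forall>x. c (g x) = gen_col x) \<and> (\<forall>x y. lt (g x) (g y) \<longleftrightarrow> gen_lt R x y)" for R g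
  have "\<exists>g. good R g" if "R \<in> posets" for R
    unfolding good_def by (rule bf_rel_iso[OF generic_gen_lt[OF that] gen])
  then obtain g where "\<And>R. R \<in> posets \<Longrightarrow> good R (g R)"
    by metis
  then have g: "\<And>R. R \<in> posets \<Longrightarrow> bij (g R)"
      "\<And>R x y. R \<in> posets \<Longrightarrow> g R x = y \<longleftrightarrow> (x, y) \<in> bf_rel (gen_lt R) gen_col lt c"
      "\<And>R x. R \<in> posets \<Longrightarrow> c (g R x) = gen_col x"
      "\<And>R x y. R \<in> posets \<Longrightarrow> lt (g R x) (g R y) \<longleftrightarrow> gen_lt R x y"
    unfolding good_def by blast+
  have g_inv [simp]: "g R (inv (g R) x) = x" "inv (g R) (g R x) = x" if "R \<in> posets" for R x
    using g(1)[OF that] by (simp_all add: bij_is_inj bij_is_surj surj_f_inv_f)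
  define \<phi> where "\<phi> = gen_map (\<lambda>p. p) 1"
  define f where "f R = g R \<circ> \<phi> \<circ> inv (g R)" for R
  have edge: "shuffle_edge lt c (g R x) (g R y) \<longleftrightarrow> shuffle_edge (gen_lt R) gen_col x y"
    if "R \<in> posets" for R x y
    using that g by (intro shuffle_edge_colour_iso) (auto simp: bij_is_inj)
  \<comment> \<open>Two uses: \<open>R = S\<close>, the identity and shift 1 give
    \<open>f R\<close>; an isomorphism \<open>h\<close> and shift 0 give the conjugator.\<close>
  have transfer: "g S \<circ> gen_map h j \<circ> inv (g R) \<in> G"
    if RS: "R \<in> posets" "S \<in> posets" and h: "bij h" "\<And>p q. R p q \<longleftrightarrow> S (h p) (h q)" for R S h j
  proof -
    have "shuffle_edge lt c x y \<longleftrightarrow>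
        shuffle_edge lt c (g S (gen_map h j (inv (g R) x))) (g S (gen_map h j (inv (g R) y)))" for x y
    proof -
      have "shuffle_edge (gen_lt S) gen_col (gen_map h j (inv (g R) x)) (gen_map h j (inv (g R) y)) \<longleftrightarrow>
          shuffle_edge (gen_lt R) gen_col (inv (g R) x) (inv (g R) y)"
        using h by (intro shuffle_edge_colour_iso gen_col_gen_map gen_lt_gen_map bij_is_inj[OF bij_gen_map])
      then show ?thesis
        using edge[OF RS(1), of "inv (g R) x" "inv (g R) y"] RS by (simp add: edge)
    qed
    moreover have "bij (g S \<circ> gen_map h j \<circ> inv (g R))"
      using g(1) RS h by (intro bij_comp bij_gen_map bij_imp_bij_inv)
    ultimately show ?thesis
      unfolding G_def digraph_aut_def by simp
  qed
  show ?thesis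
  proof (rule borel_reducibleI[where f = f])
    show "f R \<in> G" if "R \<in> posets" for R
      unfolding f_def \<phi>_def using that by (intro transfer) (auto simp: bij_id[unfolded id_def])
    have lt_meas: "Measurable.pred (restrict_space rel2_space posets) (\<lambda>R. gen_lt R a b)" for a b
      unfolding gen_lt_def by (intro measurable_restrict_space1 tlt_measurable)
    show "f \<in> measurable (restrict_space rel2_space posets) cyl_space"
    proof (rule measurable_cyl_spaceI)
      fix n
      let ?M = "restrict_space rel2_space posets"
      have "{R \<in> space ?M. f R n = m} \<in> sets ?M" for m
      proof -
        \<comment> \<open>The point \<open>a\<close> stands for \<open>inv (g R) n\<close>; naming
          it trades the inverse for a countable union of conditions on
          \<open>bf_rel\<close>.\<close>
        have "{R \<in> space ?M. f R n = m} = {R \<in> space ?M. \<exists>a.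
            (a, n) \<in> bf_rel (gen_lt R) gen_col lt c \<and> (\<phi> a, m) \<in> bf_rel (gen_lt R) gen_col lt c}"
        proof (rule Collect_cong, rule conj_cong[OF refl])
          fix R assume "R \<in> space ?M"
          then have R: "R \<in> posets" by (simp add: space_restrict_space)
          have "f R n = m \<longleftrightarrow> (\<exists>a. g R a = n \<and> g R (\<phi> a) = m)"
            using g_inv[OF R] unfolding f_def comp_def by metis
          then show "f R n = m \<longleftrightarrow> (\<exists>a. (a, n) \<in> bf_rel (gen_lt R) gen_col lt c \<and>
              (\<phi> a, m) \<in> bf_rel (gen_lt R) gen_col lt c)"
            using g(2)[OF R] by simp
        qed
        moreover have "Measurable.pred ?M (\<lambda>R. (a, b) \<in> bf_rel (gen_lt R) gen_col lt c)" for a b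
          by (rule bf_rel_measurable[where L' = "\<lambda>_. lt"]) (use lt_meas in auto)
        ultimately show ?thesis
          by (simp add: pred_def[symmetric])
      qed
      then show "(\<lambda>R. f R n) \<in> measurable ?M (count_space UNIV)"
        by (auto simp: measurable_count_space_eq2_countable vimage_def Int_def conj_commute)
    qed
    fix R S :: "nat \<Rightarrow> nat \<Rightarrow> bool" assume RS: "R \<in> posets" "S \<in> posets"
    show "iso_rel R S \<longleftrightarrow> conjugate_in G (f R) (f S)"
    proof
      assume "iso_rel R S"
      then obtain h where h: "bij h" "\<And>p q. R p q \<longleftrightarrow> S (h p) (h q)"
        unfolding iso_rel_def by blast
      define \<alpha> where "\<alpha> = g S \<circ> gen_map h 0 \<circ> inv (g R)"
      have \<alpha>: "\<alpha> \<in> G"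
        unfolding \<alpha>_def using RS h by (rule transfer)
      have comm: "gen_map h 0 (\<phi> x) = \<phi> (gen_map h 0 x)" for x
        by (simp add: \<phi>_def gen_map_def tmap_tmap)
      have "(\<alpha> \<circ> f R) x = (f S \<circ> \<alpha>) x" for x
        by (simp add: \<alpha>_def f_def RS comm)
      then have "\<alpha> \<circ> f R = f S \<circ> \<alpha>" by blast
      moreover have "surj \<alpha>"
        using \<alpha> by (simp add: G_def digraph_aut_def bij_is_surj)
      then have "\<alpha> \<circ> inv \<alpha> = id"
        by (simp only: surj_iff)
      ultimately have "\<alpha> \<circ> f R \<circ> inv \<alpha> = f S"
        by (simp add: comp_assoc)
      then show "conjugate_in G (f R) (f S)"
        using \<alpha> unfolding conjugate_in_def by blast
    next
      assume "conjugate_in G (f R) (f S)"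
      then obtain \<alpha> where \<alpha>: "\<alpha> \<in> G" "\<alpha> \<circ> f R \<circ> inv \<alpha> = f S"
        unfolding conjugate_in_def by blast
      then have bij: "bij \<alpha>" and aut: "\<And>x y. shuffle_edge lt c (\<alpha> x) (\<alpha> y) \<longleftrightarrow> shuffle_edge lt c x y"
        by (auto simp: G_def digraph_aut_def)
      have conj: "f S (\<alpha> x) = \<alpha> (f R x)" for x
        using bij by (simp add: \<alpha>(2)[symmetric] bij_is_inj)
      define b where "b R p = g R (inv term_enum (Base p))" for R p
      have fixed: "f R x = x \<longleftrightarrow> (\<exists>p. x = b R p)" if "R \<in> posets" for R x
      proof -
        have "f R x = x \<longleftrightarrow> \<phi> (inv (g R) x) = inv (g R) x"
          unfolding f_def comp_def using g_inv[OF that] by metis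
        also have "\<dots> \<longleftrightarrow> (\<exists>p. x = b R p)"
          unfolding \<phi>_def gen_map_fixed_iff b_def using g_inv[OF that] by metis
        finally show ?thesis .
      qed
      have fixed_conj: "f S (\<alpha> x) = \<alpha> x \<longleftrightarrow> f R x = x" for x
        using bij unfolding conj by (simp add: bij_is_inj inj_eq)
      have b_eq: "b R p = b R q \<longleftrightarrow> p = q" if "R \<in> posets" for R p q
        unfolding b_def using g_inv(2)[OF that] by (metis ext_term.inject(1) term_enum_inv)
      have b_edge: "shuffle_edge lt c (b R p) (b R q) \<longleftrightarrow> R p q \<and> p \<noteq> q" if "R \<in> posets" for R p q
        using g(3,4)[OF that] by (simp add: b_def shuffle_edge_def gen_col_def gen_lt_Base)
      \<comment> \<open>Conjugation carries fixed points to fixed points, so \<alpha> induces a map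
        between the underlying sets of \<open>R\<close> and \<open>S\<close>.\<close>
      have "\<exists>q. \<alpha> (b R p) = b S q" for p
        using fixed[OF RS(1)] fixed[OF RS(2)] fixed_conj by metis
      then obtain h where h: "\<And>p. \<alpha> (b R p) = b S (h p)"
        by metis
      have h_eq: "h p = h q \<longleftrightarrow> p = q" for p q
        using h b_eq[OF RS(1)] b_eq[OF RS(2)] bij by (metis bij_is_inj inj_eq)
      have "\<exists>p. h p = q" for q
      proof -
        obtain x where x: "\<alpha> x = b S q"
          using bij by (metis bij_is_surj surjD)
        then have "f R x = x"
          using fixed[OF RS(2)] fixed_conj by metis
        then show ?thesis
          using x h fixed[OF RS(1)] b_eq[OF RS(2)] by metis
      qed
      then have "bij h"
        using h_eq by (metis bijI injI surj_def)
      moreover have "R p q \<longleftrightarrow> S (h p) (h q)" for p q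
      proof (cases "p = q")
        case False
        then show ?thesis
          using b_edge[OF RS(1), of p q] b_edge[OF RS(2), of "h p" "h q"] aut[of "b R p" "b R q"]
          by (simp add: h h_eq)
      next
        case True
        \<comment> \<open>Edges record only the strict part of the order; reflexivity supplies the
          diagonal.\<close>
        have "R p p" "S (h p) (h p)"
          using RS unfolding posets_def by blast+
        then show ?thesis
          using True by simp
      qed
      ultimately show "iso_rel R S"
        unfolding iso_rel_def by blast
    qed
  qed
qed

section \<open>Coding structures in partial orders\<close>

text \<open>The chain \<open>Mark 0 < Mark 1 < \<dots>\<close> is rigid and definable, since its members are the only points
  that start a strictly increasing triple. Hence every other point carries an invariant label,
  the number of marks below it, and the labels encode symbols, truth values and positions in tuples.\<close>

datatype code_point = Mark nat | Elem nat | Tuple nat "nat list" | Entry nat "nat list" nat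

instance code_point :: countable
  by countable_datatype

text \<open>Label 0 singles out elements among the unmarked points. After subtracting 1, the parity
  of a tuple's label is its truth value. An entry exceeds its tuple's label by \<open>1 + j\<close>,
  which reveals the position and keeps the order transitive.\<close>

primrec label :: "(nat \<Rightarrow> nat list \<Rightarrow> bool) \<Rightarrow> code_point \<Rightarrow> nat" where
  "label A (Mark k) = k"
| "label A (Elem n) = 0"
| "label A (Tuple i xs) = 1 + 2 * i + of_bool (A i xs)"
| "label A (Entry i xs j) = 2 + 2 * i + of_bool (A i xs) + j"

text \<open>Entries exist for every \<open>j\<close>; those past the end of the tuple have no
  element below them, so its length can be read off.\<close>

definition code_lt :: "(nat \<Rightarrow> nat list \<Rightarrow> bool) \<Rightarrow> code_point \<Rightarrow> code_point \<Rightarrow> bool" where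
  "code_lt A x y \<longleftrightarrow> (\<exists>a < label A y. x = Mark a) \<or>
     (\<exists>i xs j. y = Entry i xs j \<and> (x = Tuple i xs \<or> (j < length xs \<and> x = Elem (xs ! j))))"

lemma code_lt_irrefl: "\<not> code_lt A x x"
  by (auto simp: code_lt_def)

lemma code_lt_trans: "code_lt A x y \<Longrightarrow> code_lt A y z \<Longrightarrow> code_lt A x z"
  by (auto simp: code_lt_def)

text \<open>Only entries lie above elements and tuples, and entries are maximal.\<close>

lemma mark_iff: "(\<exists>k. x = Mark k) \<longleftrightarrow> (\<exists>y z. code_lt A x y \<and> code_lt A y z)"
proof
  assume "\<exists>k. x = Mark k"
  then obtain k where "x = Mark k" by blast
  then have "code_lt A x (Mark (Suc k))" "code_lt A (Mark (Suc k)) (Mark (Suc (Suc k)))"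
    by (auto simp: code_lt_def)
  then show "\<exists>y z. code_lt A x y \<and> code_lt A y z" by blast
qed (auto simp: code_lt_def)

lemma code_lt_Mark: "code_lt A (Mark a) x \<longleftrightarrow> a < label A x"
  by (auto simp: code_lt_def)

text \<open>A strictly increasing map on the naturals never decreases a number; this applies to the
  inverse as well.\<close>

lemma strict_mono_bij_nat_id:
  fixes g :: "nat \<Rightarrow> nat"
  assumes "bij g" "\<And>a b. g a < g b \<longleftrightarrow> a < b"
  shows "g k = k"
proof -
  have "strict_mono g" "strict_mono (inv g)"
    using assms by (auto simp: strict_mono_def bij_is_surj surj_f_inv_f
        assms(2)[of "inv g _" "inv g _", symmetric])
  then have "k \<le> g k" "g k \<le> inv g (g k)"
    by (auto intro: strict_mono_imp_increasing)
  then show ?thesis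
    using assms(1) by (simp add: bij_is_inj)
qed

lemma code_iso_imp_iso_struct:
  assumes bij: "bij f" and f: "\<And>x y. code_lt A x y \<longleftrightarrow> code_lt B (f x) (f y)"
  shows "iso_struct A B"
proof -
  have surj: "\<exists>x. f x = y" for y
    using bij by (metis bij_is_surj surjD)
  have inj: "f x = f y \<longleftrightarrow> x = y" for x y
    using bij by (simp add: bij_is_inj inj_eq)
  have mark: "(\<exists>k. f x = Mark k) \<longleftrightarrow> (\<exists>k. x = Mark k)" for x
    unfolding mark_iff[of "f x" B] mark_iff[of x A] f by (metis surj)
  have "\<exists>l. f (Mark k) = Mark l" for k
    using mark[of "Mark k"] by blast
  then obtain g where g: "\<And>k. f (Mark k) = Mark (g k)"
    by metis
  have "bij g"
  proof (rule bijI)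
    show "inj g" using g inj by (metis code_point.inject(1) injI)
    have "\<exists>k. g k = l" for l
    proof -
      obtain x where "f x = Mark l"
        using surj by blast
      then show ?thesis
        using mark[of x] g by auto
    qed
    then show "surj g" by (metis surj_def)
  qed
  moreover have "g a < g b \<longleftrightarrow> a < b" for a b
    using f[of "Mark a" "Mark b"] by (simp add: g code_lt_Mark)
  ultimately have fMark: "f (Mark k) = Mark k" for k
    using g strict_mono_bij_nat_id by simp
  have label: "label B (f x) = label A x" for x
  proof -
    have "a < label A x \<longleftrightarrow> a < label B (f x)" for a
      using f[of "Mark a" x] by (simp add: fMark code_lt_Mark)
    then show ?thesis by (metis linorder_neq_iff)
  qed
  have "\<exists>m. f (Elem n) = Elem m" for n
    using label[of "Elem n"] mark[of "Elem n"] by (cases "f (Elem n)") auto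
  then obtain \<pi> where \<pi>: "\<And>n. f (Elem n) = Elem (\<pi> n)"
    by metis
  have Elem_surj: "\<exists>n. x = Elem n" if "f x = Elem m" for x m
    using label[of x] mark[of x] that by (cases x) auto
  have "bij \<pi>"
  proof (rule bijI)
    show "inj \<pi>" using \<pi> inj by (metis code_point.inject(2) injI)
    have "\<exists>n. \<pi> n = m" for m
    proof -
      obtain x where "f x = Elem m"
        using surj by blast
      then show ?thesis
        using Elem_surj[of x m] \<pi> by auto
    qed
    then show "surj \<pi>" by (metis surj_def)
  qed
  moreover have "A i xs \<longleftrightarrow> B i (map \<pi> xs)" for i xs
  proof -
    \<comment> \<open>Entries are recognised as the points with an unmarked point below
      them.\<close>
    have above: "(\<exists>y. (\<forall>k. y \<noteq> Mark k) \<and> code_lt A y x) \<longleftrightarrow> (\<exists>y. (\<forall>k. y \<noteq> Mark k) \<and> code_lt B y (f x))" for x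
      using mark surj f by metis
    have entry: "(\<exists>y. (\<forall>k. y \<noteq> Mark k) \<and> code_lt C y x) \<longleftrightarrow> (\<exists>i xs j. x = Entry i xs j)" for C x
      by (auto simp: code_lt_def)
    have is_entry: "(\<exists>i xs j. f x = Entry i xs j) \<longleftrightarrow> (\<exists>i xs j. x = Entry i xs j)" for x
      using above[of x] unfolding entry by simp
    obtain i' ys where ft: "f (Tuple i xs) = Tuple i' ys"
      using label[of "Tuple i xs"] mark[of "Tuple i xs"] is_entry[of "Tuple i xs"]
      by (cases "f (Tuple i xs)") auto
    then have "2 * i' + of_bool (B i' ys) = (2 * i + of_bool (A i xs) :: nat)"
      using label[of "Tuple i xs"] by simp
    then have i': "i' = i" and truth: "B i ys \<longleftrightarrow> A i xs"
      by (auto simp: of_bool_def split: if_splits; presburger)+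
    \<comment> \<open>An entry lies above exactly one tuple, which fixes \<open>i\<close> and
      \<open>ys\<close>; the label then fixes \<open>j\<close>.\<close>
    have fe: "f (Entry i xs j) = Entry i ys j" for j
    proof -
      obtain i2 zs j2 where e: "f (Entry i xs j) = Entry i2 zs j2"
        using is_entry[of "Entry i xs j"] by blast
      have "code_lt B (Tuple i ys) (Entry i2 zs j2)"
        using f[of "Tuple i xs" "Entry i xs j"] unfolding e ft i' by (simp add: code_lt_def)
      then have "i2 = i" "zs = ys"
        by (auto simp: code_lt_def)
      then show ?thesis
        using e label[of "Entry i xs j"] truth by simp
    qed
    have below: "code_lt C (Elem n) (Entry i zs j) \<longleftrightarrow> j < length zs \<and> zs ! j = n" for C n zs j
      by (auto simp: code_lt_def)
    have tr: "(j < length xs \<and> xs ! j = n) \<longleftrightarrow> (j < length ys \<and> ys ! j = \<pi> n)" for j n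
      using f[of "Elem n" "Entry i xs j"] by (simp add: fe \<pi> below)
    \<comment> \<open>Surjectivity of \<pi> is used to write the component \<open>ys ! j\<close> as
      some \<open>\<pi> n\<close>.\<close>
    have len: "j < length xs \<longleftrightarrow> j < length ys" for j
      using tr[of j] \<open>bij \<pi>\<close> by (metis bij_is_surj surjD)
    then have "length xs = length ys"
      by (metis linorder_neq_iff)
    then have "ys = map \<pi> xs"
      using tr by (intro nth_equalityI) auto
    then show ?thesis
      using truth by simp
  qed
  ultimately show ?thesis
    unfolding iso_struct_def by blast
qed

section \<open>Functoriality and measurability of the coding\<close>

primrec code_map :: "(nat \<Rightarrow> nat) \<Rightarrow> code_point \<Rightarrow> code_point" where
  "code_map h (Mark k) = Mark k"
| "code_map h (Elem n) = Elem (h n)"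
| "code_map h (Tuple i xs) = Tuple i (map h xs)"
| "code_map h (Entry i xs j) = Entry i (map h xs) j"

lemma bij_code_map:
  assumes "bij h"
  shows "bij (code_map h)"
proof (rule o_bij)
  have "inv h \<circ> h = id" "h \<circ> inv h = id"
    using assms unfolding bij_def inj_iff surj_iff by simp_all
  then have "code_map (inv h) (code_map h x) = x" "code_map h (code_map (inv h) x) = x" for x
    by (cases x; simp add: pointfree_idE)+
  then show "code_map (inv h) \<circ> code_map h = id" "code_map h \<circ> code_map (inv h) = id"
    by auto
qed

lemma code_lt_code_map:
  assumes "bij h" "\<And>i xs. A i xs \<longleftrightarrow> B i (map h xs)"
  shows "code_lt B (code_map h x) (code_map h y) \<longleftrightarrow> code_lt A x y"
proof -
  have "map h xs = map h ys \<longleftrightarrow> xs = ys" "h m = h n \<longleftrightarrow> m = n" for xs ys m n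
    using assms(1) by (auto simp: bij_is_inj inj_map_eq_map inj_eq)
  moreover have "label B (code_map h y) = label A y"
    using assms(2) by (cases y) auto
  ultimately show ?thesis
    by (cases x; cases y) (auto simp: code_lt_def)
qed

definition code_enum :: "nat \<Rightarrow> code_point" where
  "code_enum = from_nat_into UNIV"

definition code_poset :: "(nat \<Rightarrow> nat list \<Rightarrow> bool) \<Rightarrow> nat \<Rightarrow> nat \<Rightarrow> bool" where
  "code_poset A x y \<longleftrightarrow> x = y \<or> code_lt A (code_enum x) (code_enum y)"

lemma bij_code_enum: "bij code_enum"
proof -
  have "infinite (range Mark)"
    by (rule range_inj_infinite) (simp add: inj_def)
  then have "infinite (UNIV :: code_point set)"
    by (rule infinite_super[OF subset_UNIV])
  then show ?thesis
    unfolding code_enum_def by (intro bij_betw_from_nat_into) auto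
qed

lemma code_poset_posets: "code_poset A \<in> posets"
  unfolding posets_def code_poset_def using code_lt_trans code_lt_irrefl by blast

lemma iso_rel_code_poset: "iso_rel (code_poset A) (code_poset B) \<longleftrightarrow> iso_struct A B"
proof
  have e: "code_enum (inv code_enum x) = x" "inv code_enum (code_enum n) = n" for x n
    using bij_code_enum by (simp_all add: bij_is_inj bij_is_surj surj_f_inv_f)
  {
    assume "iso_rel (code_poset A) (code_poset B)"
    then obtain h where h: "bij h" "\<And>x y. code_poset A x y \<longleftrightarrow> code_poset B (h x) (h y)"
      unfolding iso_rel_def by blast
    have lt: "code_lt C x y \<longleftrightarrow> code_poset C (inv code_enum x) (inv code_enum y) \<and> x \<noteq> y" for C x y
      unfolding code_poset_def e using code_lt_irrefl e by metis
    let ?f = "code_enum \<circ> h \<circ> inv code_enum"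
    have bij: "bij ?f"
      using h(1) bij_code_enum by (intro bij_comp bij_imp_bij_inv)
    moreover have "code_lt A x y \<longleftrightarrow> code_lt B (?f x) (?f y)" for x y
      using h(2) bij unfolding lt by (simp add: e inj_eq bij_is_inj del: comp_apply) (simp add: e)
    ultimately show "iso_struct A B"
      by (rule code_iso_imp_iso_struct)
  }
  assume "iso_struct A B"
  then obtain h where h: "bij h" "\<And>i xs. A i xs \<longleftrightarrow> B i (map h xs)"
    unfolding iso_struct_def by blast
  let ?f = "inv code_enum \<circ> code_map h \<circ> code_enum"
  have bij: "bij ?f"
    using h(1) bij_code_enum by (intro bij_comp bij_imp_bij_inv bij_code_map)
  moreover have "code_poset A x y \<longleftrightarrow> code_poset B (?f x) (?f y)" for x y
  proof -
    have "?f x = ?f y \<longleftrightarrow> x = y"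
      using bij by (simp add: bij_is_inj inj_eq del: comp_apply)
    then show ?thesis
      unfolding code_poset_def using code_lt_code_map[of h A B, OF h] by (simp add: e)
  qed
  ultimately show "iso_rel (code_poset A) (code_poset B)"
    unfolding iso_rel_def by blast
qed

lemma label_measurable [measurable]: "(\<lambda>A. label A x) \<in> measurable rel2_space (count_space UNIV)"
  by (cases x) simp_all

lemma code_poset_measurable: "Measurable.pred rel2_space (\<lambda>A. code_poset A x y)"
  unfolding code_poset_def code_lt_def by measurable

text \<open>The coding does not refer to \<open>L\<close> or \<open>ar\<close>, so one map serves
  every language.\<close>

lemma structures_reducible_posets:
  "borel_reducible struct_space (Mod L ar) iso_struct rel2_space posets iso_rel"
proof (rule borel_reducibleI)
  show "code_poset \<in> measurable (restrict_space struct_space (Mod L ar)) rel2_space"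
    unfolding struct_space_def
    by (intro measurable_restrict_space1 measurable_rel2_spaceI code_poset_measurable)
qed (auto simp: code_poset_posets iso_rel_code_poset)

section \<open>Coding automorphisms as structures\<close>

definition graph_struct :: "(nat \<Rightarrow> nat \<Rightarrow> bool) \<Rightarrow> (nat \<Rightarrow> nat) \<Rightarrow> nat \<Rightarrow> nat list \<Rightarrow> bool" where
  "graph_struct E \<phi> i xs \<longleftrightarrow> length xs = 2 \<and>
     (i = 0 \<and> E (xs ! 0) (xs ! 1) \<or> i = 1 \<and> \<phi> (xs ! 0) = xs ! 1)"

text \<open>Both expansions carry the same \<open>E\<close>, so an isomorphism is an automorphism of
  the digraph; preserving the two graphs means intertwining \<phi> and \<psi>.\<close>

lemma iso_graph_struct_iff:
  "iso_struct (graph_struct E \<phi>) (graph_struct E \<psi>) \<longleftrightarrow> conjugate_in (digraph_aut E) \<phi> \<psi>"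
proof
  assume "iso_struct (graph_struct E \<phi>) (graph_struct E \<psi>)"
  then obtain \<pi> where \<pi>: "bij \<pi>"
    "\<And>i xs. graph_struct E \<phi> i xs \<longleftrightarrow> graph_struct E \<psi> i (map \<pi> xs)"
    unfolding iso_struct_def by blast
  have "E x y \<longleftrightarrow> E (\<pi> x) (\<pi> y)" for x y
    using \<pi>(2)[of 0 "[x, y]"] by (simp add: graph_struct_def)
  moreover have "\<psi> (\<pi> x) = \<pi> (\<phi> x)" for x
    using \<pi>(2)[of 1 "[x, \<phi> x]"] by (simp add: graph_struct_def)
  then have "\<pi> \<circ> \<phi> \<circ> inv \<pi> = \<psi>"
    using \<pi>(1) by (auto simp: fun_eq_iff bij_is_surj surj_f_inv_f simp flip: \<open>\<And>x. \<psi> (\<pi> x) = \<pi> (\<phi> x)\<close>)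
  ultimately show "conjugate_in (digraph_aut E) \<phi> \<psi>"
    using \<pi>(1) unfolding conjugate_in_def digraph_aut_def by blast
next
  assume "conjugate_in (digraph_aut E) \<phi> \<psi>"
  then obtain \<pi> where \<pi>: "bij \<pi>" "\<And>x y. E x y \<longleftrightarrow> E (\<pi> x) (\<pi> y)" "\<pi> \<circ> \<phi> \<circ> inv \<pi> = \<psi>"
    unfolding conjugate_in_def digraph_aut_def by blast
  have "\<psi> (\<pi> x) = \<pi> y \<longleftrightarrow> \<phi> x = y" for x y
    using \<pi>(1) by (auto simp: \<pi>(3)[symmetric] bij_is_inj inj_eq)
  then have "graph_struct E \<phi> i xs \<longleftrightarrow> graph_struct E \<psi> i (map \<pi> xs)" for i xs
    using \<pi>(2) by (auto simp: graph_struct_def)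
  then show "iso_struct (graph_struct E \<phi>) (graph_struct E \<psi>)"
    using \<pi>(1) unfolding iso_struct_def by blast
qed

lemma conjugacy_reducible_structures:
  "borel_reducible cyl_space (digraph_aut E) (conjugate_in (digraph_aut E))
     struct_space (Mod {0, 1} (\<lambda>_. 2)) iso_struct"
proof (rule borel_reducibleI)
  have "Measurable.pred cyl_space (\<lambda>\<phi>. graph_struct E \<phi> i xs)" for i xs
    unfolding graph_struct_def by measurable
  then show "graph_struct E \<in> measurable (restrict_space cyl_space (digraph_aut E)) struct_space"
    unfolding struct_space_def by (intro measurable_restrict_space1 measurable_rel2_spaceI)
qed (auto simp: iso_graph_struct_iff graph_struct_def Mod_def)

theorem theorem3p2:
  fixes lt :: "nat \<Rightarrow> nat \<Rightarrow> bool" and c :: "nat \<Rightarrow> nat"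
  assumes "generic_3col_po lt c"
  defines "Aut3 \<equiv> digraph_aut (shuffle_edge lt c)"
  shows "borel_reducible rel2_space posets iso_rel
           cyl_space Aut3 (conjugate_in Aut3)
         \<and> borel_complete cyl_space Aut3 (conjugate_in Aut3)"
proof -
  have posets: "borel_reducible rel2_space posets iso_rel cyl_space Aut3 (conjugate_in Aut3)"
    unfolding Aut3_def by (rule posets_reducible_conjugacy[OF assms(1)])
  moreover have "borel_reducible struct_space (Mod L ar) iso_struct cyl_space Aut3 (conjugate_in Aut3)" for L ar
    by (rule borel_reducible_trans[OF structures_reducible_posets posets]) (simp add: struct_space_def)
  ultimately show ?thesis
    unfolding borel_complete_def
    using conjugacy_reducible_structures[of "shuffle_edge lt c"] unfolding Aut3_def by blast
qed

end
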